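(* Let $L>0$ and suppose that $\vartheta_{\rm irrepresentable}(S,s)<1/L$, where $$\vartheta_{\rm irrepresentable}(S,s):=\max_{\|\tau_S\|_\infty\le1}\|\Sigma_{2,1}(S)\Sigma_{1,1}^{-1}(S)\tau_S\|_\infty .$$ Then $$\phi^2_{\rm compatible}(L,S)\ge\bigl(1-L\,\vartheta_{\rm irrepresentable}(S,s)\bigr)^2\Lambda^2(S,s),$$ where $$\phi_{\rm compatible}^2(L,S):=\min\left\{\frac{s\,\|f_\beta\|^2}{\|\beta_S\|_1^2}:\ \beta\in\mathbb{R}^p,\ \|\beta_{S^c}\|_1\le L\|\beta_S\|_1\ne0\right\}.$$
   Context: $Q$ is a probability measure on a measurable space, $\psi_1,\dots,\psi_p\in L_2(Q)$ are real functions, $(\cdot,\cdot)$ and $\|\cdot\|$ are the inner product and norm of $L_2(Q)$, and $f_\beta:=\sum_{j=1}^p\beta_j\psi_j$ for $\beta\in\mathbb{R}^p$. The Gram matrix is $\Sigma=(\sigma_{j,k})$, $\sigma_{j,k}:=(\psi_j,\psi_k)$, so that $\|f_\beta\|^2=\beta^T\Sigma\beta$. $S\subset\{1,\dots,p\}$ is a nonempty index set, $s:=|S|$. For an index set $\mathcal N$, $\beta_{\mathcal N}$ is the vector with entries $\beta_j1\{j\in\mathcal N\}$. $\Sigma_{1,1}(S):=(\sigma_{j,k})_{j,k\in S}$, $\Sigma_{2,1}(S):=(\sigma_{j,k})_{j\notin S,k\in S}$, and $\Lambda^2(S,s)$ is the smallest eigenvalue of $\Sigma_{1,1}(S)$.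 Standing assumption: $\Lambda^2(S,s)>0$. *)

theory Defs
  imports
    "HOL-Probability.Probability_Measure"
    "Jordan_Normal_Form.DL_Submatrix"
    "Jordan_Normal_Form.Gauss_Jordan_Elimination"
    "Jordan_Normal_Form.Spectral_Radius"
begin

unbundle no vec_syntax
no_notation inner (infix \<open>\<bullet>\<close> 70)

text \<open>
  Vectors and matrices are the explicitly sized ones of \<^theory>\<open>Jordan_Normal_Form.Matrix\<close>, whose
  entries are numbered from 0. The index set \<open>{1, ..., p}\<close> is therefore \<open>{..<p}\<close>, and
  \<^const>\<open>submatrix\<close> lists the rows and columns of an index set in increasing order.
\<close>

text \<open>Elements of \<open>L\<^sub>2(Q)\<close> are represented by functions rather than by their a.e. classes.\<close>

definition L2 :: "'a measure \<Rightarrow> ('a \<Rightarrow> real) set" where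
  "L2 Q = {f \<in> borel_measurable Q. integrable Q (\<lambda>x. (f x)\<^sup>2)}"

definition L2_inner :: "'a measure \<Rightarrow> ('a \<Rightarrow> real) \<Rightarrow> ('a \<Rightarrow> real) \<Rightarrow> real" where
  "L2_inner Q f g = (\<integral>x. f x * g x \<partial>Q)"

definition L2_norm :: "'a measure \<Rightarrow> ('a \<Rightarrow> real) \<Rightarrow> real" where
  "L2_norm Q f = sqrt (L2_inner Q f f)"

definition l1_norm :: "real vec \<Rightarrow> real" where
  "l1_norm v = (\<Sum>i<dim_vec v. \<bar>v $ i\<bar>)"

text \<open>
  The element 0 changes the maximum only for the vector without entries, which occurs as the value
  of \<open>\<Sigma>\<^sub>2\<^sub>,\<^sub>1(S) \<Sigma>\<^sub>1\<^sub>,\<^sub>1(S)\<^sup>-\<^sup>1 \<tau>\<close> if \<open>S\<close> consists of all indices.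
\<close>

definition linf_norm :: "real vec \<Rightarrow> real" where
  "linf_norm v = Max (insert 0 {\<bar>v $ i\<bar> |i. i < dim_vec v})"

definition restrict_vec :: "real vec \<Rightarrow> nat set \<Rightarrow> real vec" where
  "restrict_vec \<beta> N = vec (dim_vec \<beta>) (\<lambda>j. if j \<in> N then \<beta> $ j else 0)"

definition lin_comb :: "(nat \<Rightarrow> 'a \<Rightarrow> real) \<Rightarrow> real vec \<Rightarrow> 'a \<Rightarrow> real" where
  "lin_comb \<psi> \<beta> x = (\<Sum>j<dim_vec \<beta>. \<beta> $ j * \<psi> j x)"

definition gram :: "'a measure \<Rightarrow> (nat \<Rightarrow> 'a \<Rightarrow> real) \<Rightarrow> nat \<Rightarrow> real mat" where
  "gram Q \<psi> p = mat p p (\<lambda>(j, k). L2_inner Q (\<psi> j) (\<psi> k))"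

definition gram11 :: "'a measure \<Rightarrow> (nat \<Rightarrow> 'a \<Rightarrow> real) \<Rightarrow> nat \<Rightarrow> nat set \<Rightarrow> real mat" where
  "gram11 Q \<psi> p S = submatrix (gram Q \<psi> p) S S"

definition gram21 :: "'a measure \<Rightarrow> (nat \<Rightarrow> 'a \<Rightarrow> real) \<Rightarrow> nat \<Rightarrow> nat set \<Rightarrow> real mat" where
  "gram21 Q \<psi> p S = submatrix (gram Q \<psi> p) ({..<p} - S) S"

definition Lambda_sq :: "'a measure \<Rightarrow> (nat \<Rightarrow> 'a \<Rightarrow> real) \<Rightarrow> nat \<Rightarrow> nat set \<Rightarrow> real" where
  "Lambda_sq Q \<psi> p S = Min (spectrum (gram11 Q \<psi> p S))"

text \<open>
  The next two quantities are an attained maximum and an attained minimum over infinite sets, hence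
  the use of \<^const>\<open>Greatest\<close> and \<^const>\<open>Least\<close> instead of \<^const>\<open>Max\<close> and \<^const>\<open>Min\<close>.
\<close>

definition theta_irrepresentable ::
  "'a measure \<Rightarrow> (nat \<Rightarrow> 'a \<Rightarrow> real) \<Rightarrow> nat \<Rightarrow> nat set \<Rightarrow> real" where
  "theta_irrepresentable Q \<psi> p S =
    (GREATEST t. \<exists>\<tau> \<in> carrier_vec (card S). linf_norm \<tau> \<le> 1 \<and>
       t = linf_norm (gram21 Q \<psi> p S *\<^sub>v (the (mat_inverse (gram11 Q \<psi> p S)) *\<^sub>v \<tau>)))"

definition phi_compatible_sq ::
  "'a measure \<Rightarrow> (nat \<Rightarrow> 'a \<Rightarrow> real) \<Rightarrow> nat \<Rightarrow> real \<Rightarrow> nat set \<Rightarrow> real" where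
  "phi_compatible_sq Q \<psi> p L S =
    (LEAST t. \<exists>\<beta> \<in> carrier_vec p.
       l1_norm (restrict_vec \<beta> ({..<p} - S)) \<le> L * l1_norm (restrict_vec \<beta> S) \<and>
       l1_norm (restrict_vec \<beta> S) \<noteq> 0 \<and>
       t = real (card S) * (L2_norm Q (lin_comb \<psi> \<beta>))\<^sup>2 / (l1_norm (restrict_vec \<beta> S))\<^sup>2)"

end

theory Submission
  imports Defs
begin

text \<open>
  The projection of \<open>f\<^sub>\<beta>\<close> onto the span of the \<open>\<psi>\<^sub>k\<close> with \<open>k \<in> S\<close>
  has no larger norm, and its coefficients are \<open>b = \<beta>\<^sub>S + A\<^sup>T \<beta>\<^sub>N\<close>, where \<open>N\<close> is the complement
  of \<open>S\<close> and \<open>A = \<Sigma>\<^sub>2\<^sub>,\<^sub>1 \<Sigma>\<^sub>1\<^sub>,\<^sub>1\<^sup>-\<^sup>1\<close>. The irrepresentable constant \<open>\<theta>\<close> is the largest \<open>l\<^sub>1\<close>-norm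
  of a row of \<open>A\<close>, so \<open>\<parallel>b\<parallel>\<^sub>1 \<ge> \<parallel>\<beta>\<^sub>S\<parallel>\<^sub>1 - \<theta> \<parallel>\<beta>\<^sub>N\<parallel>\<^sub>1 \<ge> (1 - L \<theta>) \<parallel>\<beta>\<^sub>S\<parallel>\<^sub>1\<close>, and the squared norm
  of the projection is at least \<open>\<Lambda>\<^sup>2 \<parallel>b\<parallel>\<^sub>2\<^sup>2 \<ge> \<Lambda>\<^sup>2 \<parallel>b\<parallel>\<^sub>1\<^sup>2 / s\<close>.
\<close>

section \<open>Real functions in \<open>L\<^sub>2\<close>\<close>

text \<open>The product is dominated by the integrable function f^2 + g^2.\<close>

lemma L2_integrable_mult:
  assumes "f \<in> L2 Q" "g \<in> L2 Q"
  shows "integrable Q (\<lambda>x. f x * g x)"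
proof (rule Bochner_Integration.integrable_bound)
  show "integrable Q (\<lambda>x. (f x)\<^sup>2 + (g x)\<^sup>2)"
    using assms by (auto simp: L2_def)
  show "(\<lambda>x. f x * g x) \<in> borel_measurable Q"
    using assms by (auto simp: L2_def)
  have "\<bar>a * b\<bar> \<le> a\<^sup>2 + b\<^sup>2" for a b :: real
    using sum_squares_bound[of "\<bar>a\<bar>" "\<bar>b\<bar>"] abs_ge_zero[of "a * b"]
    unfolding abs_mult power2_abs by linarith
  then show "AE x in Q. norm (f x * g x) \<le> norm ((f x)\<^sup>2 + (g x)\<^sup>2)"
    by simp
qed

lemma L2_add:
  assumes "f \<in> L2 Q" "g \<in> L2 Q"
  shows "(\<lambda>x. f x + g x) \<in> L2 Q"
proof -
  have "(f x + g x)\<^sup>2 = f x * f x + 2 * (f x * g x) + g x * g x" for x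
    by (simp add: power2_eq_square algebra_simps)
  then show ?thesis
    using assms by (auto simp: L2_def intro!: Bochner_Integration.integrable_add
        integrable_mult_right L2_integrable_mult[unfolded L2_def])
qed

lemma L2_scale: "f \<in> L2 Q \<Longrightarrow> (\<lambda>x. c * f x) \<in> L2 Q"
  by (auto simp: L2_def power_mult_distrib)

lemma L2_sum:
  assumes "finite I" "\<And>i. i \<in> I \<Longrightarrow> f i \<in> L2 Q"
  shows "(\<lambda>x. \<Sum>i\<in>I. a i * f i x) \<in> L2 Q"
  using assms
proof (induction I rule: finite_induct)
  case empty
  show ?case by (simp add: L2_def)
next
  case (insert i I)
  then show ?case by (simp add: L2_add L2_scale)
qed

lemma L2_inner_commute: "L2_inner Q f g = L2_inner Q g f"
  by (simp add: L2_inner_def mult.commute)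

lemma L2_inner_self_nonneg: "0 \<le> L2_inner Q f f"
  by (simp add: L2_inner_def)

lemma L2_norm_sq: "(L2_norm Q f)\<^sup>2 = L2_inner Q f f"
  by (simp add: L2_norm_def L2_inner_self_nonneg)

lemma L2_inner_sum_left:
  assumes "\<And>i. i \<in> I \<Longrightarrow> f i \<in> L2 Q" "g \<in> L2 Q"
  shows "L2_inner Q (\<lambda>x. \<Sum>i\<in>I. a i * f i x) g = (\<Sum>i\<in>I. a i * L2_inner Q (f i) g)"
proof -
  have "L2_inner Q (\<lambda>x. \<Sum>i\<in>I. a i * f i x) g = (\<integral>x. (\<Sum>i\<in>I. a i * (f i x * g x)) \<partial>Q)"
    by (simp add: L2_inner_def sum_distrib_right mult.assoc)
  also have "\<dots> = (\<Sum>i\<in>I. \<integral>x. a i * (f i x * g x) \<partial>Q)"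
    by (intro Bochner_Integration.integral_sum integrable_mult_right L2_integrable_mult assms)
  finally show ?thesis by (simp add: L2_inner_def)
qed

lemma L2_inner_sum_sum:
  assumes "finite I" "\<And>i. i \<in> I \<Longrightarrow> f i \<in> L2 Q"
  shows "L2_inner Q (\<lambda>x. \<Sum>i\<in>I. a i * f i x) (\<lambda>x. \<Sum>i\<in>I. a i * f i x) =
    (\<Sum>i\<in>I. a i * (\<Sum>j\<in>I. a j * L2_inner Q (f i) (f j)))"
proof -
  have "L2_inner Q (f i) (\<lambda>x. \<Sum>j\<in>I. a j * f j x) = (\<Sum>j\<in>I. a j * L2_inner Q (f i) (f j))"
    if "i \<in> I" for i
    using assms that by (subst (1 2) L2_inner_commute) (simp add: L2_inner_sum_left)
  then show ?thesis
    using assms by (simp add: L2_inner_sum_left L2_sum)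
qed

lemma L2_inner_add_self:
  assumes "f \<in> L2 Q" "g \<in> L2 Q"
  shows "L2_inner Q (\<lambda>x. f x + g x) (\<lambda>x. f x + g x) =
    L2_inner Q f f + 2 * L2_inner Q f g + L2_inner Q g g"
proof -
  have "(f x + g x) * (f x + g x) = f x * f x + 2 * (f x * g x) + g x * g x" for x
    by (simp add: algebra_simps)
  then show ?thesis
    using assms by (simp add: L2_inner_def L2_integrable_mult)
qed

section \<open>The smallest eigenvalue of a real symmetric matrix\<close>

text \<open>By Tychonoff the cube with sides \<open>{-M..M}\<close> is compact in the product
  topology, hence so is every closed subset of it. Both minima needed below, of the Rayleigh
  quotient and of the compatibility ratio, are found among coordinate functions
  \<open>nat => real\<close> in this way.\<close>

lemma continuous_attains_inf_bounded:
  fixes F :: "('i \<Rightarrow> real) \<Rightarrow> real"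
  assumes "closed C" "C \<noteq> {}" "\<And>x i. x \<in> C \<Longrightarrow> \<bar>x i\<bar> \<le> M" "continuous_on UNIV F"
  obtains x where "x \<in> C" "\<And>y. y \<in> C \<Longrightarrow> F x \<le> F y"
proof -
  have "compactin (product_topology (\<lambda>i::'i. euclidean) UNIV) (PiE UNIV (\<lambda>i. {-M..M}))"
    by (subst compactin_PiE) simp
  then have "compact (PiE UNIV (\<lambda>i::'i. {-M..M}))"
    by (simp add: euclidean_product_topology)
  moreover have "C \<subseteq> PiE UNIV (\<lambda>i. {-M..M})"
    using assms(3) by (auto simp: abs_le_iff minus_le_iff)
  ultimately have "compact C"
    using assms(1) by (metis compact_Int_closed inf.absorb_iff2 inf_commute)
  then show ?thesis
    using continuous_attains_inf[of C F] assms that by (metis continuous_on_subset subset_UNIV)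
qed

text \<open>This is the first-order condition at a minimum: a quadratic that vanishes at 0 and is
  nonnegative everywhere has derivative 0 there.\<close>

lemma linear_coeff_eq_0:
  fixes b c :: real
  assumes "\<And>t. 0 \<le> 2 * t * b + t\<^sup>2 * c"
  shows "b = 0"
proof (rule ccontr)
  assume "b \<noteq> 0"
  \<comment> \<open>With \<open>k > 0\<close> and \<open>c < k\<close>, the point
    \<open>t = - b / k\<close> gives the linear term the upper hand: \<open>c / k - 2\<close> is
    negative, whatever the sign of \<open>c\<close>.\<close>
  define k where "k = \<bar>c\<bar> + 1"
  have k: "k > 0" "c < k" by (auto simp: k_def)
  have "2 * (- b / k) * b + (- b / k)\<^sup>2 * c = (b\<^sup>2 / k) * (c / k - 2)"
    by (simp add: power2_eq_square algebra_simps)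
  also have "\<dots> < 0"
    using \<open>b \<noteq> 0\<close> k by (intro mult_pos_neg) (auto simp: field_simps)
  finally show False
    using assms[of "- b / k"] by linarith
qed

lemma scalar_prod_self_eq_sum:
  fixes v :: "real vec"
  shows "v \<in> carrier_vec n \<Longrightarrow> v \<bullet> v = (\<Sum>i<n. (v $ i)\<^sup>2)"
  by (auto simp: scalar_prod_def power2_eq_square lessThan_atLeast0)

lemma quadratic_form_eq_sum:
  assumes "A \<in> carrier_mat n n" "v \<in> carrier_vec n"
  shows "v \<bullet> (A *\<^sub>v v) = (\<Sum>i<n. v $ i * (\<Sum>j<n. A $$ (i, j) * v $ j))"
  using assms by (simp add: scalar_prod_def lessThan_atLeast0)

text \<open>The quadratic form attains its minimum on the unit sphere, at an eigenvector.\<close>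

lemma Min_spectrum_mult_le:
  fixes A :: "real mat"
  assumes A: "A \<in> carrier_mat n n" and sym: "transpose_mat A = A" and v: "v \<in> carrier_vec n"
  shows "Min (spectrum A) * (v \<bullet> v) \<le> v \<bullet> (A *\<^sub>v v)"
proof (cases "n = 0")
  \<comment> \<open>Both scalar products are empty sums here, so the value of \<open>Min\<close> on
    an empty spectrum does no harm.\<close>
  case True
  then show ?thesis
    using A v by (simp add: scalar_prod_def)
next
  case False
  define q where "q u = u \<bullet> (A *\<^sub>v u)" for u
  \<comment> \<open>\<open>C\<close> is the unit sphere in the first \<open>n\<close> coordinates.
    The box condition also confines the coordinates from \<open>n\<close> on, which makes
    \<open>C\<close> compact.\<close>
  define C where "C = {x::nat \<Rightarrow> real. (\<forall>i. \<bar>x i\<bar> \<le> 1) \<and> (\<Sum>i<n. (x i)\<^sup>2) = 1}"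
  have q_vec: "q (vec n x) = (\<Sum>i<n. x i * (\<Sum>j<n. A $$ (i, j) * x j))" for x
    using A by (simp add: q_def quadratic_form_eq_sum)
  have "continuous_on UNIV (\<lambda>x. q (vec n x))"
    unfolding q_vec by (intro continuous_intros continuous_on_product_coordinates)
  moreover have "closed C"
    unfolding C_def
    by (intro closed_Collect_conj closed_Collect_all closed_Collect_le closed_Collect_eq
        continuous_intros continuous_on_product_coordinates)
  moreover have "(\<lambda>i. if i = 0 then 1 else 0) \<in> C"
    using False by (simp add: C_def if_distrib[of "\<lambda>x. x\<^sup>2"] cong: if_cong)
  then have "C \<noteq> {}" by blast
  moreover have "\<bar>x i\<bar> \<le> 1" if "x \<in> C" for x i
    using that by (simp add: C_def)
  ultimately obtain x where x: "x \<in> C" and min: "\<And>y. y \<in> C \<Longrightarrow> q (vec n x) \<le> q (vec n y)"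
    using continuous_attains_inf_bounded[of C 1 "\<lambda>x. q (vec n x)"] by metis
  define w where "w = vec n x"
  define m where "m = q w"
  have w: "w \<in> carrier_vec n" by (simp add: w_def)
  have ww: "w \<bullet> w = 1"
    using x by (simp add: scalar_prod_self_eq_sum[OF w] C_def) (simp add: w_def)
  \<comment> \<open>The bound passes from the sphere to all vectors because both sides are
    homogeneous of degree 2.\<close>
  have rayleigh: "m * (u \<bullet> u) \<le> q u" if u: "u \<in> carrier_vec n" for u
  proof (cases "u \<bullet> u = 0")
    case True
    then have "u $ i = 0" if "i < n" for i
      using that by (simp add: scalar_prod_self_eq_sum[OF u] sum_nonneg_eq_0_iff)
    then show ?thesis
      using True u A by (simp add: q_def quadratic_form_eq_sum)
  next
    case False
    define r where "r = sqrt (u \<bullet> u)"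
    have "u \<bullet> u \<ge> 0"
      by (simp add: scalar_prod_self_eq_sum[OF u] sum_nonneg)
    with False have r: "r > 0" and r2: "r\<^sup>2 = u \<bullet> u"
      by (auto simp: r_def)
    \<comment> \<open>Padding with zeros from \<open>n\<close> on keeps the box condition of
      \<open>C\<close>.\<close>
    define y where "y i = (if i < n then u $ i / r else 0)" for i
    have "\<bar>u $ i\<bar> \<le> r" if "i < n" for i
    proof -
      have "(u $ i)\<^sup>2 \<le> u \<bullet> u"
        unfolding scalar_prod_self_eq_sum[OF u] using that by (intro member_le_sum) auto
      then show ?thesis unfolding r_def by (rule real_le_rsqrt[of "\<bar>u $ i\<bar>", simplified])
    qed
    then have "\<bar>y i\<bar> \<le> 1" for i
      using r by (simp add: y_def)
    moreover have "(\<Sum>i<n. (y i)\<^sup>2) = 1"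
      using False r2 by (simp add: y_def power_divide scalar_prod_self_eq_sum[OF u]
          flip: sum_divide_distrib)
    ultimately have "m \<le> q (vec n y)"
      using min by (simp add: m_def w_def C_def)
    also have "q (vec n y) = q u / r\<^sup>2"
      using A u unfolding q_vec
      by (simp add: y_def q_def quadratic_form_eq_sum power2_eq_square
          flip: sum_divide_distrib)
    finally show ?thesis
      using r by (simp add: r2[symmetric] field_simps)
  qed
  \<comment> \<open>The residual of the eigenvalue equation is taken as the direction in which the
    minimizer \<open>w\<close> is perturbed; minimality will force it to be 0.\<close>
  define h where "h = A *\<^sub>v w - m \<cdot>\<^sub>v w"
  have h: "h \<in> carrier_vec n" using A w by (simp add: h_def)
  have Aw: "A *\<^sub>v w \<in> carrier_vec n" and Ah: "A *\<^sub>v h \<in> carrier_vec n"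
    using A w h by auto
  \<comment> \<open>Symmetry of \<open>A\<close> enters here and merges the two cross terms of the
    perturbed quadratic form.\<close>
  have wAh: "w \<bullet> (A *\<^sub>v h) = h \<bullet> (A *\<^sub>v w)"
    using transpose_vec_mult_scalar[OF A h w] sym comm_scalar_prod[OF h Aw] by simp
  have "h \<bullet> h = h \<bullet> (A *\<^sub>v w) - m * (h \<bullet> w)"
    using h Aw w by (subst (2) h_def) (simp add: scalar_prod_minus_distrib)
  then have hAw: "h \<bullet> (A *\<^sub>v w) = h \<bullet> h + m * (h \<bullet> w)" by simp
  have q_add: "q (w + t \<cdot>\<^sub>v h) =
      m + t * (w \<bullet> (A *\<^sub>v h)) + t * (h \<bullet> (A *\<^sub>v w)) + t\<^sup>2 * q h" for t
  proof -
    have "A *\<^sub>v (w + t \<cdot>\<^sub>v h) = A *\<^sub>v w + t \<cdot>\<^sub>v (A *\<^sub>v h)"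
      using A w h by (simp add: mult_add_distrib_mat_vec mult_mat_vec)
    then show ?thesis
      using w h Aw Ah by (simp add: m_def q_def add_scalar_prod_distrib[of _ n]
          scalar_prod_add_distrib[of _ n] power2_eq_square algebra_simps)
  qed
  have norm_add: "(w + t \<cdot>\<^sub>v h) \<bullet> (w + t \<cdot>\<^sub>v h) =
      1 + 2 * t * (h \<bullet> w) + t\<^sup>2 * (h \<bullet> h)" for t
    using w h ww comm_scalar_prod[OF h w] by (simp add: add_scalar_prod_distrib[of _ n]
          scalar_prod_add_distrib[of _ n] power2_eq_square algebra_simps)
  \<comment> \<open>In the Rayleigh bound at \<open>w + t h\<close> the constants cancel, and
    \<open>hAw\<close> turns the linear coefficient into the squared length of
    \<open>h\<close>.\<close>
  have "0 \<le> 2 * t * (h \<bullet> h) + t\<^sup>2 * (q h - m * (h \<bullet> h))" for t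
    using rayleigh[of "w + t \<cdot>\<^sub>v h"] w h
    by (simp add: q_add norm_add wAh hAw algebra_simps)
  then have "h \<bullet> h = 0"
    by (rule linear_coeff_eq_0)
  then have "h $ i = 0" if "i < n" for i
    using that by (simp add: scalar_prod_self_eq_sum[OF h] sum_nonneg_eq_0_iff)
  then have "A *\<^sub>v w = m \<cdot>\<^sub>v w"
    using A w by (intro eq_vecI) (auto simp: h_def)
  moreover have "w \<noteq> 0\<^sub>v n" using ww by auto
  ultimately have "eigenvector A w m"
    using A w by (simp add: eigenvector_def)
  then have "m \<in> spectrum A"
    by (auto simp: spectrum_def eigenvalue_def)
  then have "Min (spectrum A) \<le> m"
    using card_finite_spectrum(1)[OF A] by simp
  then have "Min (spectrum A) * (v \<bullet> v) \<le> m * (v \<bullet> v)"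
    by (intro mult_right_mono) (simp_all add: scalar_prod_self_eq_sum[OF v] sum_nonneg)
  with rayleigh[OF v] show ?thesis by (simp add: q_def)
qed

text \<open>A nonzero kernel vector would be an eigenvector for 0; hence the determinant is nonzero
  and \<open>A\<close> is a unit.\<close>

lemma mat_inverse_exists:
  fixes A :: "'b :: field mat"
  assumes A: "A \<in> carrier_mat n n" and "0 \<notin> spectrum A"
  obtains B where "mat_inverse A = Some B"
proof -
  have "A *\<^sub>v v \<noteq> 0\<^sub>v n" if "v \<in> carrier_vec n" "v \<noteq> 0\<^sub>v n" for v
  proof -
    have "0 \<cdot>\<^sub>v v = 0\<^sub>v n" using that(1) by (intro eq_vecI) auto
    moreover have "\<not> eigenvector A v 0"
      using assms(2) by (auto simp: spectrum_def eigenvalue_def)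
    ultimately show ?thesis using that A by (simp add: eigenvector_def)
  qed
  then have "det A \<noteq> 0"
    using det_0_iff_vec_prod_zero_field[OF A] by auto
  then show ?thesis
    using det_non_zero_imp_unit[OF A, where b = "()"] mat_inverse(1)[OF A, where b = "()"] that
    by (cases "mat_inverse A") auto
qed

section \<open>Norms and index sets\<close>

text \<open>The inverse map counts the elements of \<open>I\<close> below a given one. This turns
  sums over submatrix positions into sums over index sets.\<close>

lemma bij_betw_pick:
  assumes "finite I"
  shows "bij_betw (pick I) {..<card I} I"
proof (rule bij_betwI')
  show "pick I i \<in> I" if "i \<in> {..<card I}" for i
    using that by (simp add: pick_in_set)
  show "pick I i = pick I j \<longleftrightarrow> i = j" if "i \<in> {..<card I}" "j \<in> {..<card I}" for i j
    using that card_pick[of i I] card_pick[of j I] by (metis lessThan_iff)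
  show "\<exists>i\<in>{..<card I}. k = pick I i" if "k \<in> I" for k
  proof
    show "k = pick I (card {a \<in> I. a < k})"
      using that by (simp add: pick_card_in_set)
    show "card {a \<in> I. a < k} \<in> {..<card I}"
      using that assms by (auto intro!: psubset_card_mono)
  qed
qed

lemma sum_pick: "finite I \<Longrightarrow> (\<Sum>i<card I. f (pick I i)) = sum f I"
  by (rule sum.reindex_bij_betw[OF bij_betw_pick])

lemma l1_norm_restrict_vec:
  assumes "N \<subseteq> {..<dim_vec \<beta>}"
  shows "l1_norm (restrict_vec \<beta> N) = (\<Sum>j\<in>N. \<bar>\<beta> $ j\<bar>)"
  unfolding l1_norm_def restrict_vec_def using assms
  by (intro sum.mono_neutral_cong_right) auto

lemma linf_norm_le_iff: "linf_norm v \<le> c \<longleftrightarrow> 0 \<le> c \<and> (\<forall>i<dim_vec v. \<bar>v $ i\<bar> \<le> c)"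
  by (auto simp: linf_norm_def)

text \<open>The operator norm from sup norm to sup norm is the largest absolute row sum, attained at
  the signs of that row. The element 0 covers a matrix without rows.\<close>

lemma Greatest_linf_norm_mult_mat_vec:
  assumes A: "A \<in> carrier_mat m n"
  shows "(GREATEST t. \<exists>\<tau>\<in>carrier_vec n. linf_norm \<tau> \<le> 1 \<and> t = linf_norm (A *\<^sub>v \<tau>)) =
    Max (insert 0 ((\<lambda>i. \<Sum>l<n. \<bar>A $$ (i, l)\<bar>) ` {..<m}))"
proof -
  define row where "row i = (\<Sum>l<n. \<bar>A $$ (i, l)\<bar>)" for i
  define G where "G = Max (insert 0 (row ` {..<m}))"
  have row_le: "row i \<le> G" if "i < m" for i
    using that by (simp add: G_def)
  have "0 \<le> G" by (simp add: G_def)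
  have Av: "(A *\<^sub>v \<tau>) $ k = (\<Sum>l<n. A $$ (k, l) * \<tau> $ l)"
    if "k < m" "\<tau> \<in> carrier_vec n" for k \<tau>
    using A that by (simp add: scalar_prod_def lessThan_atLeast0)
  have upper: "linf_norm (A *\<^sub>v \<tau>) \<le> G" if \<tau>: "\<tau> \<in> carrier_vec n" "linf_norm \<tau> \<le> 1" for \<tau>
  proof -
    have "\<bar>(A *\<^sub>v \<tau>) $ k\<bar> \<le> G" if k: "k < m" for k
    proof -
      have "\<bar>(A *\<^sub>v \<tau>) $ k\<bar> \<le> (\<Sum>l<n. \<bar>A $$ (k, l)\<bar> * \<bar>\<tau> $ l\<bar>)"
        unfolding Av[OF k \<tau>(1)] abs_mult[symmetric] by (rule sum_abs)
      also have "\<dots> \<le> (\<Sum>l<n. \<bar>A $$ (k, l)\<bar> * 1)"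
        using \<tau> by (intro sum_mono mult_left_mono) (auto simp: linf_norm_le_iff)
      finally show ?thesis using row_le[OF k] by (simp add: row_def)
    qed
    then show ?thesis using A \<open>0 \<le> G\<close> by (simp add: linf_norm_le_iff)
  qed
  have lower: "\<exists>\<tau>\<in>carrier_vec n. linf_norm \<tau> \<le> 1 \<and> G \<le> linf_norm (A *\<^sub>v \<tau>)"
  proof (cases "G = 0")
    case True
    \<comment> \<open>Comparing the norm with itself in \<open>linf_norm_le_iff\<close> yields its
      nonnegativity, so the zero vector already reaches \<open>G\<close>.\<close>
    then show ?thesis
      using linf_norm_le_iff[of "A *\<^sub>v 0\<^sub>v n" "linf_norm (A *\<^sub>v 0\<^sub>v n)"]
      by (intro bexI[of _ "0\<^sub>v n"]) (auto simp: linf_norm_le_iff)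
  next
    case False
    have "G \<in> insert 0 (row ` {..<m})"
      unfolding G_def by (intro Max_in) auto
    with False obtain i where i: "i < m" "G = row i" by auto
    \<comment> \<open>The signs of a maximal row turn each summand of its product with \<tau> into
      an absolute value.\<close>
    define \<tau> where "\<tau> = vec n (\<lambda>l. sgn (A $$ (i, l)))"
    have \<tau>: "\<tau> \<in> carrier_vec n" "linf_norm \<tau> \<le> 1"
      by (auto simp: \<tau>_def linf_norm_le_iff abs_sgn_eq)
    have "(A *\<^sub>v \<tau>) $ i = G"
      by (simp add: Av[OF i(1) \<tau>(1)]) (simp add: i \<tau>_def row_def abs_sgn)
    then have "G \<le> linf_norm (A *\<^sub>v \<tau>)"
      using linf_norm_le_iff[of "A *\<^sub>v \<tau>" "linf_norm (A *\<^sub>v \<tau>)"] i A by force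
    with \<tau> show ?thesis by blast
  qed
  have "(GREATEST t. \<exists>\<tau>\<in>carrier_vec n. linf_norm \<tau> \<le> 1 \<and> t = linf_norm (A *\<^sub>v \<tau>)) = G"
    using lower upper by (intro Greatest_equality) (auto intro: antisym)
  then show ?thesis by (simp add: G_def row_def[abs_def])
qed

section \<open>Gram matrices and the compatibility constant\<close>

lemma gram11_carrier: "S \<subseteq> {..<p} \<Longrightarrow> gram11 Q \<psi> p S \<in> carrier_mat (card S) (card S)"
  by (intro carrier_matI) (auto simp: gram11_def gram_def dim_submatrix intro!: arg_cong[of _ _ card])

lemma gram11_index:
  assumes "S \<subseteq> {..<p}" "i < card S" "j < card S"
  shows "gram11 Q \<psi> p S $$ (i, j) = L2_inner Q (\<psi> (pick S i)) (\<psi> (pick S j))"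
proof -
  have "{i. i < p \<and> i \<in> S} = S" using assms by auto
  moreover have "pick S i < p" "pick S j < p"
    using assms pick_in_set[of i S] pick_in_set[of j S] by auto
  ultimately show ?thesis
    using assms by (simp add: gram11_def gram_def submatrix_index)
qed

lemma gram21_carrier:
  "S \<subseteq> {..<p} \<Longrightarrow> gram21 Q \<psi> p S \<in> carrier_mat (card ({..<p} - S)) (card S)"
  by (intro carrier_matI) (auto simp: gram21_def gram_def dim_submatrix intro!: arg_cong[of _ _ card])

lemma gram21_index:
  assumes "S \<subseteq> {..<p}" "i < card ({..<p} - S)" "j < card S"
  shows "gram21 Q \<psi> p S $$ (i, j) =
    L2_inner Q (\<psi> (pick ({..<p} - S) i)) (\<psi> (pick S j))"
proof -
  have "{i. i < p \<and> i \<in> S} = S" "{i. i < p \<and> i \<in> {..<p} - S} = {..<p} - S"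
    using assms by auto
  moreover have "pick ({..<p} - S) i < p" "pick S j < p"
    using assms pick_in_set[of i "{..<p} - S"] pick_in_set[of j S] by auto
  ultimately show ?thesis
    using assms by (simp add: gram21_def gram_def submatrix_index)
qed

lemma gram11_symmetric:
  "S \<subseteq> {..<p} \<Longrightarrow> transpose_mat (gram11 Q \<psi> p S) = gram11 Q \<psi> p S"
  using gram11_carrier[of S p Q \<psi>]
  by (intro eq_matI) (auto simp: gram11_index intro: L2_inner_commute)

text \<open>A positive smallest eigenvalue keeps 0 out of the spectrum, so the \<open>the\<close> in
  the definition of \<open>theta_irrepresentable\<close> meets a genuine inverse.\<close>

lemma gram11_inverse:
  assumes "S \<subseteq> {..<p}" "Lambda_sq Q \<psi> p S > 0"
  obtains B where "mat_inverse (gram11 Q \<psi> p S) = Some B" "B \<in> carrier_mat (card S) (card S)"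
    "B * gram11 Q \<psi> p S = 1\<^sub>m (card S)"
proof -
  note G = gram11_carrier[OF assms(1), of Q \<psi>]
  have "0 \<notin> spectrum (gram11 Q \<psi> p S)"
    using assms(2) Min_le[OF card_finite_spectrum(1)[OF G], of 0] by (auto simp: Lambda_sq_def)
  then obtain B where B: "mat_inverse (gram11 Q \<psi> p S) = Some B"
    using mat_inverse_exists[OF G] by metis
  from that[OF this] mat_inverse(2)[OF G this] show ?thesis by blast
qed

lemma theta_irrepresentable_eq_Max:
  assumes "S \<subseteq> {..<p}" "mat_inverse (gram11 Q \<psi> p S) = Some B" "B \<in> carrier_mat (card S) (card S)"
  shows "theta_irrepresentable Q \<psi> p S = Max (insert 0
    ((\<lambda>j. \<Sum>l<card S. \<bar>(gram21 Q \<psi> p S * B) $$ (j, l)\<bar>) ` {..<card ({..<p} - S)}))"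
proof -
  note G21 = gram21_carrier[OF assms(1), of Q \<psi>]
  have "(\<exists>\<tau>\<in>carrier_vec (card S). linf_norm \<tau> \<le> 1 \<and>
      t = linf_norm ((gram21 Q \<psi> p S * B) *\<^sub>v \<tau>)) \<longleftrightarrow>
    (\<exists>\<tau>\<in>carrier_vec (card S). linf_norm \<tau> \<le> 1 \<and>
      t = linf_norm (gram21 Q \<psi> p S *\<^sub>v (B *\<^sub>v \<tau>)))" for t
    by (intro bex_cong refl) (simp add: assoc_mult_mat_vec[OF G21 assms(3)])
  then have "theta_irrepresentable Q \<psi> p S = (GREATEST t. \<exists>\<tau>\<in>carrier_vec (card S).
      linf_norm \<tau> \<le> 1 \<and> t = linf_norm ((gram21 Q \<psi> p S * B) *\<^sub>v \<tau>))"
    by (simp add: theta_irrepresentable_def assms(2))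
  also have "\<dots> = Max (insert 0
      ((\<lambda>j. \<Sum>l<card S. \<bar>(gram21 Q \<psi> p S * B) $$ (j, l)\<bar>) ` {..<card ({..<p} - S)}))"
    by (rule Greatest_linf_norm_mult_mat_vec[OF mult_carrier_mat[OF G21 assms(3)]])
  finally show ?thesis .
qed

text \<open>By homogeneity the minimum may be taken over the compact set where
  \<open>\<parallel>\<beta>\<^sub>S\<parallel>\<^sub>1 = 1\<close>.\<close>

lemma phi_compatible_sq_attained:
  assumes \<psi>: "\<And>j. j < p \<Longrightarrow> \<psi> j \<in> L2 Q" and S: "S \<subseteq> {..<p}" "S \<noteq> {}" and "L > 0"
  obtains \<beta> where "\<beta> \<in> carrier_vec p"
    "l1_norm (restrict_vec \<beta> ({..<p} - S)) \<le> L * l1_norm (restrict_vec \<beta> S)"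
    "l1_norm (restrict_vec \<beta> S) \<noteq> 0"
    "phi_compatible_sq Q \<psi> p L S =
      real (card S) * (L2_norm Q (lin_comb \<psi> \<beta>))\<^sup>2 / (l1_norm (restrict_vec \<beta> S))\<^sup>2"
proof -
  define F where "F x = (L2_norm Q (lin_comb \<psi> (vec p x)))\<^sup>2" for x
  \<comment> \<open>After normalization, coordinates in \<open>S\<close> are at most 1 and those in
    the complement at most \<open>L\<close> in absolute value. The box with bound
    \<open>max 1 L\<close> thus excludes no normalized vector, and it also bounds the coordinates
    from \<open>p\<close> on.\<close>
  define C where "C = {x::nat \<Rightarrow> real. (\<forall>i. \<bar>x i\<bar> \<le> max 1 L) \<and>
    (\<Sum>j\<in>S. \<bar>x j\<bar>) = 1 \<and> (\<Sum>j\<in>{..<p} - S. \<bar>x j\<bar>) \<le> L}"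
  have "finite S" using S finite_subset by blast
  have l1: "l1_norm (restrict_vec \<beta> S) = (\<Sum>j\<in>S. \<bar>\<beta> $ j\<bar>)"
    "l1_norm (restrict_vec \<beta> ({..<p} - S)) = (\<Sum>j\<in>{..<p} - S. \<bar>\<beta> $ j\<bar>)"
    if "\<beta> \<in> carrier_vec p" for \<beta>
    using that S by (auto intro!: l1_norm_restrict_vec)
  have F: "F x = (\<Sum>i<p. x i * (\<Sum>j<p. x j * L2_inner Q (\<psi> i) (\<psi> j)))" for x
  proof -
    have "lin_comb \<psi> (vec p x) = (\<lambda>t. \<Sum>i<p. x i * \<psi> i t)"
      by (auto simp: lin_comb_def)
    then show ?thesis
      using L2_inner_sum_sum[of "{..<p}" \<psi> Q x] \<psi> by (simp add: F_def L2_norm_sq)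
  qed
  have "continuous_on UNIV F"
    unfolding F by (intro continuous_intros continuous_on_product_coordinates)
  moreover have "closed C"
    unfolding C_def
    by (intro closed_Collect_conj closed_Collect_all closed_Collect_le closed_Collect_eq
        continuous_intros continuous_on_product_coordinates)
  moreover have "C \<noteq> {}"
  proof -
    obtain k where "k \<in> S" using S by auto
    \<comment> \<open>A unit vector supported in \<open>S\<close> satisfies the cone condition
      trivially.\<close>
    then have "(\<lambda>i. if i = k then 1 else 0) \<in> C"
      using \<open>finite S\<close> \<open>L > 0\<close> by (simp add: C_def le_max_iff_disj if_distrib[of abs] cong: if_cong)
    then show ?thesis by blast
  qed
  moreover have "\<bar>x i\<bar> \<le> max 1 L" if "x \<in> C" for x i
    using that unfolding C_def by blast
  ultimately obtain x where x: "x \<in> C" and min: "\<And>y. y \<in> C \<Longrightarrow> F x \<le> F y"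
    using continuous_attains_inf_bounded[of C "max 1 L" F] by metis
  define \<beta> where "\<beta> = vec p x"
  have \<beta>: "\<beta> \<in> carrier_vec p" by (simp add: \<beta>_def)
  have "(\<Sum>j\<in>S. \<bar>\<beta> $ j\<bar>) = (\<Sum>j\<in>S. \<bar>x j\<bar>)"
    using S by (intro sum.cong) (auto simp: \<beta>_def)
  moreover have "(\<Sum>j\<in>{..<p} - S. \<bar>\<beta> $ j\<bar>) = (\<Sum>j\<in>{..<p} - S. \<bar>x j\<bar>)"
    by (intro sum.cong) (auto simp: \<beta>_def)
  ultimately have \<beta>S: "l1_norm (restrict_vec \<beta> S) = 1"
    and \<beta>N: "l1_norm (restrict_vec \<beta> ({..<p} - S)) \<le> L"
    using x by (simp_all add: l1[OF \<beta>] C_def)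
  have least: "real (card S) * F x \<le>
      real (card S) * (L2_norm Q (lin_comb \<psi> \<gamma>))\<^sup>2 / (l1_norm (restrict_vec \<gamma> S))\<^sup>2"
    if \<gamma>: "\<gamma> \<in> carrier_vec p"
      "l1_norm (restrict_vec \<gamma> ({..<p} - S)) \<le> L * l1_norm (restrict_vec \<gamma> S)"
      "l1_norm (restrict_vec \<gamma> S) \<noteq> 0" for \<gamma>
  proof -
    define a where "a = l1_norm (restrict_vec \<gamma> S)"
    have a: "a = (\<Sum>j\<in>S. \<bar>\<gamma> $ j\<bar>)" by (simp add: a_def l1[OF \<gamma>(1)])
    then have "a > 0"
      using \<gamma>(3) by (simp add: a_def order_less_le sum_nonneg l1[OF \<gamma>(1)])
    have \<gamma>N: "(\<Sum>j\<in>{..<p} - S. \<bar>\<gamma> $ j\<bar>) \<le> L * a"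
      using \<gamma>(2) by (simp add: l1[OF \<gamma>(1)] a)
    \<comment> \<open>Dividing by the l1-norm of \<gamma> on \<open>S\<close> moves the vector into
      \<open>C\<close>; the ratio to be minimized is unchanged.\<close>
    define y where "y i = (if i < p then \<gamma> $ i / a else 0)" for i
    have "\<bar>y i\<bar> \<le> max 1 L" for i
    proof -
      consider "i \<in> S" | "i \<in> {..<p} - S" | "\<not> i < p" by auto
      then show ?thesis
      proof cases
        case 1
        then have "\<bar>\<gamma> $ i\<bar> \<le> a"
          unfolding a using \<open>finite S\<close> by (intro member_le_sum) auto
        then show ?thesis using \<open>a > 0\<close> by (simp add: y_def le_max_iff_disj)
      next
        case 2
        then have "\<bar>\<gamma> $ i\<bar> \<le> (\<Sum>j\<in>{..<p} - S. \<bar>\<gamma> $ j\<bar>)"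
          by (intro member_le_sum) auto
        then have "\<bar>\<gamma> $ i\<bar> \<le> L * a" using \<gamma>N by linarith
        then show ?thesis using \<open>a > 0\<close> \<open>L > 0\<close>
          by (simp add: y_def le_max_iff_disj pos_divide_le_eq)
      qed (simp add: y_def)
    qed
    moreover have "(\<Sum>j\<in>S. \<bar>y j\<bar>) = (\<Sum>j\<in>S. \<bar>\<gamma> $ j\<bar> / a)"
      using S \<open>a > 0\<close> by (intro sum.cong) (auto simp: y_def)
    then have "(\<Sum>j\<in>S. \<bar>y j\<bar>) = 1"
      using \<open>a > 0\<close> a by (simp flip: sum_divide_distrib)
    moreover have "(\<Sum>j\<in>{..<p} - S. \<bar>y j\<bar>) = (\<Sum>j\<in>{..<p} - S. \<bar>\<gamma> $ j\<bar> / a)"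
      using \<open>a > 0\<close> by (intro sum.cong) (auto simp: y_def)
    then have "(\<Sum>j\<in>{..<p} - S. \<bar>y j\<bar>) \<le> L"
      using \<open>a > 0\<close> \<gamma>N by (simp add: pos_divide_le_eq flip: sum_divide_distrib)
    ultimately have "F x \<le> F y" using min by (simp add: C_def)
    also have "F y = F (\<lambda>i. \<gamma> $ i) / a\<^sup>2"
      unfolding F by (simp add: y_def power2_eq_square flip: sum_divide_distrib)
    also have "vec p (\<lambda>i. \<gamma> $ i) = \<gamma>" using \<gamma>(1) by auto
    then have "F (\<lambda>i. \<gamma> $ i) = (L2_norm Q (lin_comb \<psi> \<gamma>))\<^sup>2" by (simp add: F_def)
    finally have "real (card S) * F x \<le> real (card S) * ((L2_norm Q (lin_comb \<psi> \<gamma>))\<^sup>2 / a\<^sup>2)"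
      by (intro mult_left_mono) auto
    then show ?thesis by (simp add: a_def)
  qed
  have "phi_compatible_sq Q \<psi> p L S = real (card S) * F x"
    unfolding phi_compatible_sq_def
  proof (rule Least_equality)
    show "\<exists>\<beta>\<in>carrier_vec p.
       l1_norm (restrict_vec \<beta> ({..<p} - S)) \<le> L * l1_norm (restrict_vec \<beta> S) \<and>
       l1_norm (restrict_vec \<beta> S) \<noteq> 0 \<and>
       real (card S) * F x =
         real (card S) * (L2_norm Q (lin_comb \<psi> \<beta>))\<^sup>2 / (l1_norm (restrict_vec \<beta> S))\<^sup>2"
      using \<beta> \<beta>S \<beta>N by (intro bexI[of _ \<beta>]) (simp_all add: F_def \<beta>_def)
  qed (use least in blast)
  then show ?thesis
    using that[OF \<beta>] \<beta>S \<beta>N by (simp add: F_def \<beta>_def)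
qed

section \<open>Lower bound for the norm by projection\<close>

lemma theta_irrepresentable_nonneg:
  assumes "S \<subseteq> {..<p}" "Lambda_sq Q \<psi> p S > 0"
  shows "0 \<le> theta_irrepresentable Q \<psi> p S"
proof -
  obtain B where "mat_inverse (gram11 Q \<psi> p S) = Some B" "B \<in> carrier_mat (card S) (card S)"
    using gram11_inverse[OF assms] by metis
  then show ?thesis by (simp add: theta_irrepresentable_eq_Max[OF assms(1)])
qed

text \<open>This is the projection bound with the two l1-norms kept separate, for an arbitrary
  \<beta>; the cone condition and \<open>L\<close> come in only afterwards.\<close>

lemma Lambda_sq_mult_le_L2_norm:
  assumes \<psi>: "\<And>j. j < p \<Longrightarrow> \<psi> j \<in> L2 Q" and S: "S \<subseteq> {..<p}"
    and pos: "Lambda_sq Q \<psi> p S > 0" and \<beta>: "\<beta> \<in> carrier_vec p"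
    and nonneg: "0 \<le> (\<Sum>j\<in>S. \<bar>\<beta> $ j\<bar>) -
      theta_irrepresentable Q \<psi> p S * (\<Sum>j\<in>{..<p} - S. \<bar>\<beta> $ j\<bar>)"
  shows "((\<Sum>j\<in>S. \<bar>\<beta> $ j\<bar>) -
      theta_irrepresentable Q \<psi> p S * (\<Sum>j\<in>{..<p} - S. \<bar>\<beta> $ j\<bar>))\<^sup>2 * Lambda_sq Q \<psi> p S
    \<le> real (card S) * (L2_norm Q (lin_comb \<psi> \<beta>))\<^sup>2"
proof -
  define N where "N = {..<p} - S"
  define s where "s = card S"
  define q where "q = card N"
  define e where "e = pick S"
  define d where "d = pick N"
  define \<theta> where "\<theta> = theta_irrepresentable Q \<psi> p S"
  define G where "G = gram11 Q \<psi> p S"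
  define H where "H = gram21 Q \<psi> p S"
  have fin: "finite S" "finite N" using S finite_subset by (auto simp: N_def)
  have sum_e: "(\<Sum>k<s. f (e k)) = sum f S" for f :: "nat \<Rightarrow> real"
    unfolding s_def e_def by (rule sum_pick[OF fin(1)])
  have sum_d: "(\<Sum>j<q. f (d j)) = sum f N" for f :: "nat \<Rightarrow> real"
    unfolding q_def d_def by (rule sum_pick[OF fin(2)])
  have \<psi>e: "\<psi> (e k) \<in> L2 Q" if "k < s" for k
    using that S pick_in_set[of k S] by (intro \<psi>) (auto simp: s_def e_def)
  have \<psi>d: "\<psi> (d j) \<in> L2 Q" if "j < q" for j
    using that pick_in_set[of j N] by (intro \<psi>) (auto simp: q_def d_def N_def)
  have G: "G \<in> carrier_mat s s" and H: "H \<in> carrier_mat q s"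
    using S by (simp_all add: G_def H_def s_def q_def N_def gram11_carrier gram21_carrier)
  have G_index: "G $$ (k, l) = L2_inner Q (\<psi> (e k)) (\<psi> (e l))" if "k < s" "l < s" for k l
    using that S by (simp add: G_def s_def e_def gram11_index)
  have H_index: "H $$ (j, k) = L2_inner Q (\<psi> (d j)) (\<psi> (e k))" if "j < q" "k < s" for j k
    using that S by (simp add: H_def s_def q_def N_def e_def d_def gram21_index)
  have G_sym: "transpose_mat G = G" using S by (simp add: G_def gram11_symmetric)
  have \<Lambda>: "Lambda_sq Q \<psi> p S = Min (spectrum G)" by (simp add: Lambda_sq_def G_def)
  obtain B where inv: "mat_inverse G = Some B" and B: "B \<in> carrier_mat s s"
    and BG: "B * G = 1\<^sub>m s"
    using gram11_inverse[OF S pos] unfolding G_def s_def by metis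
  define A where "A = H * B"
  have A: "A \<in> carrier_mat q s" using H B by (simp add: A_def)
  have "\<theta> = Max (insert 0 ((\<lambda>j. \<Sum>l<s. \<bar>A $$ (j, l)\<bar>) ` {..<q}))"
    using theta_irrepresentable_eq_Max[OF S, of Q \<psi> B] inv B
    unfolding A_def H_def G_def s_def q_def N_def \<theta>_def by blast
  then have row: "(\<Sum>l<s. \<bar>A $$ (j, l)\<bar>) \<le> \<theta>" if "j < q" for j
    using that by simp
  \<comment> \<open>These are the normal equations: row \<open>j\<close> of \<open>A\<close> holds
    the coefficients of the projection of the \<open>j\<close>-th function outside \<open>S\<close>
    onto the span of those in \<open>S\<close>.\<close>
  have "A * G = H"
    using B G H BG by (simp add: A_def assoc_mult_mat[OF H B G])
  define x where "x k = \<beta> $ e k" for k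
  define y where "y j = \<beta> $ d j" for j
  \<comment> \<open>\<open>c\<close> collects the projection coefficients of the part of the linear
    combination outside \<open>S\<close>. Adding and subtracting it splits the combination into its
    projection \<open>h\<close> and the residual \<open>g\<close>.\<close>
  define c where "c l = (\<Sum>j<q. A $$ (j, l) * y j)" for l
  define b where "b l = x l + c l" for l
  define h where "h t = (\<Sum>k<s. b k * \<psi> (e k) t)" for t
  define g where "g t = (\<Sum>j<q. y j * \<psi> (d j) t) + (\<Sum>k<s. (- c k) * \<psi> (e k) t)" for t
  have L2h: "h \<in> L2 Q"
    unfolding h_def[abs_def] using \<psi>e by (intro L2_sum) auto
  have L2y: "(\<lambda>t. \<Sum>j<q. y j * \<psi> (d j) t) \<in> L2 Q" and
    L2c: "(\<lambda>t. \<Sum>k<s. (- c k) * \<psi> (e k) t) \<in> L2 Q"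
    using \<psi>e \<psi>d by (intro L2_sum; simp)+
  have L2g: "g \<in> L2 Q"
    unfolding g_def[abs_def] by (rule L2_add[OF L2y L2c])
  have "lin_comb \<psi> \<beta> t = h t + g t" for t
  proof -
    have "lin_comb \<psi> \<beta> t = (\<Sum>j\<in>S \<union> N. \<beta> $ j * \<psi> j t)"
      using \<beta> S by (simp add: lin_comb_def N_def Un_absorb1 sup.commute)
    also have "\<dots> = (\<Sum>k<s. x k * \<psi> (e k) t) + (\<Sum>j<q. y j * \<psi> (d j) t)"
      using fin sum.union_disjoint[of S N "\<lambda>j. \<beta> $ j * \<psi> j t"]
        sum_e[of "\<lambda>j. \<beta> $ j * \<psi> j t"] sum_d[of "\<lambda>j. \<beta> $ j * \<psi> j t"]
      by (simp add: x_def y_def N_def)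
    finally show ?thesis
      by (simp add: h_def g_def b_def algebra_simps sum.distrib sum_negf)
  qed
  then have f_eq: "lin_comb \<psi> \<beta> = (\<lambda>t. h t + g t)" by blast
  \<comment> \<open>The residual is orthogonal to the span, by the normal equations read entry by
    entry.\<close>
  have gk: "L2_inner Q g (\<psi> (e k)) = 0" if k: "k < s" for k
  proof -
    have "L2_inner Q g (\<psi> (e k)) = (\<Sum>j<q. y j * H $$ (j, k)) - (\<Sum>l<s. c l * G $$ (l, k))"
    proof -
      have "L2_inner Q g (\<psi> (e k)) = L2_inner Q (\<lambda>t. \<Sum>j<q. y j * \<psi> (d j) t) (\<psi> (e k)) +
          L2_inner Q (\<lambda>t. \<Sum>l<s. (- c l) * \<psi> (e l) t) (\<psi> (e k))"
        using L2_integrable_mult[OF L2y \<psi>e[OF k]] L2_integrable_mult[OF L2c \<psi>e[OF k]]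
        by (simp add: L2_inner_def g_def ring_distribs(2) del: mult_minus_left)
      also have "\<dots> = (\<Sum>j<q. y j * L2_inner Q (\<psi> (d j)) (\<psi> (e k))) +
          (\<Sum>l<s. (- c l) * L2_inner Q (\<psi> (e l)) (\<psi> (e k)))"
        using \<psi>e \<psi>d k
        by (intro arg_cong2[where f = "(+)"] L2_inner_sum_left) auto
      finally show ?thesis using k by (simp add: H_index G_index sum_negf)
    qed
    moreover have "(\<Sum>l<s. c l * G $$ (l, k)) = (\<Sum>j<q. y j * (\<Sum>l<s. A $$ (j, l) * G $$ (l, k)))"
      unfolding c_def sum_distrib_left sum_distrib_right
      by (subst sum.swap) (simp add: ac_simps)
    moreover have "(\<Sum>l<s. A $$ (j, l) * G $$ (l, k)) = H $$ (j, k)" if "j < q" for j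
      using that k A G \<open>A * G = H\<close>[symmetric] by (simp add: scalar_prod_def lessThan_atLeast0)
    ultimately show ?thesis by simp
  qed
  have "L2_inner Q h g = (\<Sum>k<s. b k * L2_inner Q (\<psi> (e k)) g)"
    unfolding h_def[abs_def] using \<psi>e L2g by (intro L2_inner_sum_left) auto
  then have hg: "L2_inner Q h g = 0"
    using gk by (simp add: L2_inner_commute[of Q _ g])
  have v: "vec s b \<in> carrier_vec s" by simp
  have "L2_inner Q h h = vec s b \<bullet> (G *\<^sub>v vec s b)"
    unfolding quadratic_form_eq_sum[OF G v] h_def[abs_def]
    using L2_inner_sum_sum[of "{..<s}" "\<lambda>k. \<psi> (e k)" Q b] \<psi>e by (simp add: G_index mult.commute)
  then have "Lambda_sq Q \<psi> p S * (\<Sum>k<s. (b k)\<^sup>2) \<le> L2_inner Q h h"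
    using Min_spectrum_mult_le[OF G G_sym v] by (simp add: \<Lambda> scalar_prod_self_eq_sum[OF v])
  \<comment> \<open>Pythagoras: the cross term vanishes and the squared norm of \<open>g\<close> is
    dropped.\<close>
  also have "\<dots> \<le> (L2_norm Q (lin_comb \<psi> \<beta>))\<^sup>2"
    by (simp add: L2_norm_sq f_eq L2_inner_add_self[OF L2h L2g] hg L2_inner_self_nonneg)
  finally have norm_ge: "Lambda_sq Q \<psi> p S * (\<Sum>k<s. (b k)\<^sup>2) \<le> (L2_norm Q (lin_comb \<psi> \<beta>))\<^sup>2" .
  \<comment> \<open>By duality, row sums of \<open>A\<close> bounded by \<theta> bound the l1-norm
    of the transpose of \<open>A\<close> applied to \<open>y\<close>.\<close>
  have "(\<Sum>l<s. \<bar>c l\<bar>) \<le> (\<Sum>l<s. \<Sum>j<q. \<bar>y j\<bar> * \<bar>A $$ (j, l)\<bar>)"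
    unfolding c_def by (intro sum_mono order_trans[OF sum_abs]) (simp add: abs_mult mult.commute)
  also have "\<dots> = (\<Sum>j<q. \<bar>y j\<bar> * (\<Sum>l<s. \<bar>A $$ (j, l)\<bar>))"
    by (subst sum.swap) (simp add: sum_distrib_left)
  also have "\<dots> \<le> (\<Sum>j<q. \<bar>y j\<bar> * \<theta>)"
    using row by (intro sum_mono mult_left_mono) auto
  also have "\<dots> = \<theta> * (\<Sum>j\<in>N. \<bar>\<beta> $ j\<bar>)"
    by (simp add: y_def sum_d[of "\<lambda>j. \<bar>\<beta> $ j\<bar>"] mult.commute flip: sum_distrib_left)
  finally have c_le: "(\<Sum>l<s. \<bar>c l\<bar>) \<le> \<theta> * (\<Sum>j\<in>N. \<bar>\<beta> $ j\<bar>)" .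
  have "(\<Sum>j\<in>S. \<bar>\<beta> $ j\<bar>) = (\<Sum>k<s. \<bar>x k\<bar>)"
    by (simp add: x_def sum_e[of "\<lambda>j. \<bar>\<beta> $ j\<bar>"])
  also have "\<dots> \<le> (\<Sum>k<s. \<bar>b k\<bar> + \<bar>c k\<bar>)"
    by (intro sum_mono) (simp add: b_def)
  finally have "(\<Sum>j\<in>S. \<bar>\<beta> $ j\<bar>) - \<theta> * (\<Sum>j\<in>N. \<bar>\<beta> $ j\<bar>) \<le> (\<Sum>k<s. \<bar>b k\<bar>)"
    using c_le by (simp add: sum.distrib)
  \<comment> \<open>Squaring preserves the inequality because \<open>nonneg\<close> makes its left
    side nonnegative.\<close>
  then have "((\<Sum>j\<in>S. \<bar>\<beta> $ j\<bar>) - \<theta> * (\<Sum>j\<in>N. \<bar>\<beta> $ j\<bar>))\<^sup>2 \<le> (\<Sum>k<s. \<bar>b k\<bar>)\<^sup>2"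
    using nonneg by (intro power_mono) (simp_all add: \<theta>_def N_def)
  \<comment> \<open>Cauchy-Schwarz produces the factor \<open>s\<close>.\<close>
  also have "\<dots> \<le> real s * (\<Sum>k<s. (b k)\<^sup>2)"
    using sum_squared_le_sum_of_squares[of "\<lambda>k. \<bar>b k\<bar>" "{..<s}"] by (simp add: mult.commute)
  finally have "((\<Sum>j\<in>S. \<bar>\<beta> $ j\<bar>) - \<theta> * (\<Sum>j\<in>N. \<bar>\<beta> $ j\<bar>))\<^sup>2 * Lambda_sq Q \<psi> p S
      \<le> real s * (\<Sum>k<s. (b k)\<^sup>2) * Lambda_sq Q \<psi> p S"
    using pos by (intro mult_right_mono) auto
  also have "\<dots> \<le> real s * (L2_norm Q (lin_comb \<psi> \<beta>))\<^sup>2"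
    using mult_left_mono[OF norm_ge, of "real s"] by (simp add: ac_simps)
  finally show ?thesis by (simp add: \<theta>_def N_def s_def)
qed

theorem theorem9p1:
  fixes Q :: "'a measure" and \<psi> :: "nat \<Rightarrow> 'a \<Rightarrow> real" and p :: nat
    and S :: "nat set" and L :: real
  assumes "prob_space Q"
    and "\<And>j. j < p \<Longrightarrow> \<psi> j \<in> L2 Q"
    and "S \<subseteq> {..<p}" and "S \<noteq> {}"
    and "Lambda_sq Q \<psi> p S > 0"
    and "L > 0"
    and "theta_irrepresentable Q \<psi> p S < 1 / L"
  shows "phi_compatible_sq Q \<psi> p L S
    \<ge> (1 - L * theta_irrepresentable Q \<psi> p S)\<^sup>2 * Lambda_sq Q \<psi> p S"
proof -
  define \<theta> where "\<theta> = theta_irrepresentable Q \<psi> p S"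
  \<comment> \<open>Since the minimum is attained, it suffices to bound the ratio at one
    minimizer.\<close>
  obtain \<beta> where \<beta>: "\<beta> \<in> carrier_vec p"
    and cone: "l1_norm (restrict_vec \<beta> ({..<p} - S)) \<le> L * l1_norm (restrict_vec \<beta> S)"
    and "l1_norm (restrict_vec \<beta> S) \<noteq> 0"
    and phi: "phi_compatible_sq Q \<psi> p L S =
      real (card S) * (L2_norm Q (lin_comb \<psi> \<beta>))\<^sup>2 / (l1_norm (restrict_vec \<beta> S))\<^sup>2"
    using phi_compatible_sq_attained[of p \<psi> Q S L] assms by metis
  define a where "a = (\<Sum>j\<in>S. \<bar>\<beta> $ j\<bar>)"
  define n where "n = (\<Sum>j\<in>{..<p} - S. \<bar>\<beta> $ j\<bar>)"
  have l1: "l1_norm (restrict_vec \<beta> S) = a" "l1_norm (restrict_vec \<beta> ({..<p} - S)) = n"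
    using \<beta> assms(3) by (auto simp: a_def n_def intro!: l1_norm_restrict_vec)
  then have "n \<le> L * a" using cone by simp
  have "a > 0"
    using l1 \<open>l1_norm (restrict_vec \<beta> S) \<noteq> 0\<close> by (simp add: a_def order_less_le sum_nonneg)
  have "L * \<theta> < 1"
    using assms(6,7) by (simp add: \<theta>_def field_simps)
  have "0 \<le> \<theta>"
    unfolding \<theta>_def by (rule theta_irrepresentable_nonneg[OF assms(3,5)])
  \<comment> \<open>Nonnegativity of \<theta> permits multiplying the cone condition by it.\<close>
  then have "\<theta> * n \<le> L * \<theta> * a"
    using mult_left_mono[OF \<open>n \<le> L * a\<close>, of \<theta>] by (simp add: ac_simps)
  then have le: "(1 - L * \<theta>) * a \<le> a - \<theta> * n"
    by (simp add: algebra_simps)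
  \<comment> \<open>The bound on \<theta> by \<open>1 / L\<close> serves here: it allows squaring
    \<open>le\<close>, and it supplies the nonnegativity that the projection bound demands.\<close>
  have nonneg: "0 \<le> (1 - L * \<theta>) * a"
    using \<open>L * \<theta> < 1\<close> \<open>a > 0\<close> by simp
  have "((1 - L * \<theta>) * a)\<^sup>2 * Lambda_sq Q \<psi> p S \<le> (a - \<theta> * n)\<^sup>2 * Lambda_sq Q \<psi> p S"
    using le nonneg assms(5) by (intro mult_right_mono power_mono) auto
  also have "\<dots> \<le> real (card S) * (L2_norm Q (lin_comb \<psi> \<beta>))\<^sup>2"
    using Lambda_sq_mult_le_L2_norm[of p \<psi> Q S \<beta>] assms \<beta> le nonneg
    by (simp add: a_def n_def \<theta>_def)
  finally show ?thesis
    using \<open>a > 0\<close> unfolding phi l1 \<theta>_def[symmetric]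
    by (simp add: pos_le_divide_eq power_mult_distrib ac_simps)
qed

end
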